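(* Assume that there exist constants $T>e_{\ast}$, $C_T>1$ and $0<\theta<1$ such that every solution $t\mapsto x(t)$ of $x'=A(t)x$ satisfies $$|x(t)|\leq C_T|x(s)| \quad \text{for } e_{\ast}\leq s\leq t\leq s\ast T,$$ $$|x(t)|\leq \theta \sup_{|u\ast t^{\ast-1}|_{\ast}\leq T}|x(u)| \quad \text{for } t\geq T.$$ Then the system $x'=A(t)x$ has a uniform $h$-dichotomy on $[e_{\ast},+\infty)$.
   Context: Let $J=(a_0,+\infty)$ with $a_0\in\mathbb{R}$, or $J=\mathbb{R}$ (i.e. $a_0=-\infty$). Let $A\colon J\to M_n(\mathbb{R})$ be continuous and consider the linear system $x'=A(t)x$, $t\in J$. $\Phi(t)$ denotes a fundamental matrix and $\Phi(t,s)=\Phi(t)\Phi^{-1}(s)$ the transition matrix. $|\cdot|$ is a norm on $\mathbb{R}^n$ and $\|\cdot\|$ its induced matrix norm. A growth rate is a strictly increasing homeomorphism $h\colon J\to(0,+\infty)$; $h$ is a fixed growth rate. On $J$ define the abelian group operation $t\ast s:=h^{-1}(h(t)h(s))$, with unit $e_{\ast}:=h^{-1}(1)$ and inverse $t^{\ast-1}:=h^{-1}(1/h(t))$. Define $|t|_{\ast}=t$ if $e_{\ast}\leq t$ and $|t|_{\ast}=t^{\ast-1}$ if $t<e_{\ast}$. Thus, for $T>e_\ast$, $|u\ast t^{\ast-1}|_{\ast}\leq T$ means $t\ast T^{\ast-1}\leq u\leq t\ast T$. The system has a uniform $h$-dichotomy on an interval $\mathcal{I}\subset J$ if there exist projectors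 $P(t)$ ($P(t)^2=P(t)$, $t\in J$) and constants $K\geq 1$, $\alpha>0$ such that $P(t)\Phi(t,s)=\Phi(t,s)P(s)$ for all $t,s\in J$, and, with $Q(t)=I-P(t)$: $\|\Phi(t,s)P(s)\|\leq K(h(t)/h(s))^{-\alpha}$ for all $t\geq s$ with $t,s\in\mathcal{I}$, and $\|\Phi(t,s)Q(s)\|\leq K(h(s)/h(t))^{-\alpha}$ for all $s\geq t$ with $t,s\in\mathcal{I}$. *)

theory Defs
  imports "HOL-Analysis.Analysis"
begin

definition is_norm :: "('a::real_vector \<Rightarrow> real) \<Rightarrow> bool" where
  "is_norm N \<longleftrightarrow>
     (\<forall>x. 0 \<le> N x) \<and> (\<forall>x. N x = 0 \<longleftrightarrow> x = 0) \<and>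
     (\<forall>c x. N (c *\<^sub>R x) = \<bar>c\<bar> * N x) \<and> (\<forall>x y. N (x + y) \<le> N x + N y)"

definition induced_norm :: "(real^'n \<Rightarrow> real) \<Rightarrow> real^'n^'n \<Rightarrow> real" where
  "induced_norm N M = (SUP x\<in>{x. N x = 1}. N (M *v x))"

definition growth_rate :: "real set \<Rightarrow> (real \<Rightarrow> real) \<Rightarrow> bool" where
  "growth_rate J h \<longleftrightarrow> strict_mono_on J h \<and> homeomorphism J {0<..} h (inv_into J h)"

definition star :: "real set \<Rightarrow> (real \<Rightarrow> real) \<Rightarrow> real \<Rightarrow> real \<Rightarrow> real" where
  "star J h t s = inv_into J h (h t * h s)"

definition star_unit :: "real set \<Rightarrow> (real \<Rightarrow> real) \<Rightarrow> real" where
  "star_unit J h = inv_into J h 1"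

definition star_inv :: "real set \<Rightarrow> (real \<Rightarrow> real) \<Rightarrow> real \<Rightarrow> real" where
  "star_inv J h t = inv_into J h (1 / h t)"

definition star_abs :: "real set \<Rightarrow> (real \<Rightarrow> real) \<Rightarrow> real \<Rightarrow> real" where
  "star_abs J h t = (if star_unit J h \<le> t then t else star_inv J h t)"

text \<open>The domain \<open>J\<close> is always an open interval below, so two-sided derivatives are the right ones.\<close>

definition is_solution :: "real set \<Rightarrow> (real \<Rightarrow> real^'n^'n) \<Rightarrow> (real \<Rightarrow> real^'n) \<Rightarrow> bool" where
  "is_solution J A x \<longleftrightarrow> (\<forall>t\<in>J. (x has_vector_derivative (A t *v x t)) (at t))"

definition fundamental_matrix ::
  "real set \<Rightarrow> (real \<Rightarrow> real^'n^'n) \<Rightarrow> (real \<Rightarrow> real^'n^'n) \<Rightarrow> bool" where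
  "fundamental_matrix J A \<Phi> \<longleftrightarrow>
     (\<forall>t\<in>J. (\<Phi> has_vector_derivative (A t ** \<Phi> t)) (at t) \<and> invertible (\<Phi> t))"

definition transition :: "(real \<Rightarrow> real^'n^'n) \<Rightarrow> real \<Rightarrow> real \<Rightarrow> real^'n^'n" where
  "transition \<Phi> t s = \<Phi> t ** matrix_inv (\<Phi> s)"

text \<open>The transition matrix does not depend on which fundamental matrix is chosen, so the
  existential quantifier over \<open>\<Phi>\<close> only fixes some choice of it; projectors are defined
  and commute with the transition matrix on all of \<open>J\<close>, whereas the estimates are
  required on the interval \<open>I\<close> only.\<close>

definition uniform_dichotomy ::
  "real set \<Rightarrow> (real \<Rightarrow> real) \<Rightarrow> (real^'n \<Rightarrow> real) \<Rightarrow> (real \<Rightarrow> real^'n^'n) \<Rightarrow> real set \<Rightarrow> bool" where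
  "uniform_dichotomy J h N A I \<longleftrightarrow>
     is_interval I \<and> I \<subseteq> J \<and>
     (\<exists>\<Phi> P K \<alpha>.
        fundamental_matrix J A \<Phi> \<and> 1 \<le> K \<and> 0 < \<alpha> \<and>
        (\<forall>t\<in>J. P t ** P t = P t) \<and>
        (\<forall>t\<in>J. \<forall>s\<in>J. P t ** transition \<Phi> t s = transition \<Phi> t s ** P s) \<and>
        (\<forall>t\<in>I. \<forall>s\<in>I. s \<le> t \<longrightarrow>
           induced_norm N (transition \<Phi> t s ** P s) \<le> K * (h t / h s) powr (- \<alpha>)) \<and>
        (\<forall>t\<in>I. \<forall>s\<in>I. t \<le> s \<longrightarrow>
           induced_norm N (transition \<Phi> t s ** (mat 1 - P s)) \<le> K * (h s / h t) powr (- \<alpha>)))"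

end

theory Submission
  imports Defs
begin

text \<open>
  In the time \<open>\<tau> = ln (h t)\<close> the hypotheses become Coppel's: along every solution the norm \<open>f\<close>
  grows at most by \<open>C\<close> over time \<open>L = ln (h T)\<close>, and \<open>f \<tau> \<le> \<theta> sup f\<close> over \<open>[\<tau> - L, \<tau> + L]\<close>. If \<open>f\<close> is
  bounded, its supremum over \<open>[\<sigma>, \<infinity>)\<close> shrinks by \<open>\<theta>\<close> with each step \<open>L\<close>, so \<open>f\<close> decays
  exponentially. Otherwise the running maximum of \<open>f\<close>, once above \<open>C f 0\<close>, grows by \<open>1/\<theta>\<close> with each
  step, and it is comparable to \<open>f\<close>. The projection is onto the bounded solutions along any
  complement; compactness of the unit sphere of the complement bounds the time at which the growth
  sets in, and bounded growth keeps the angle between the two subspaces away from zero.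
\<close>

section \<open>Linear differential equations on an open interval\<close>

lemma open_interval_cover:
  fixes J :: "real set"
  assumes "open J" "is_interval J" "s \<in> J" "t \<in> J"
  obtains a b where "a < s" "s < b" "a < t" "t < b" "{a..b} \<subseteq> J"
proof -
  have "min s t \<in> J" "max s t \<in> J" using assms by (auto simp: min_def max_def)
  then obtain d e where d: "d > 0" "cball (min s t) d \<subseteq> J" and e: "e > 0" "cball (max s t) e \<subseteq> J"
    using \<open>open J\<close> open_contains_cball by metis
  have mem: "min s t - d \<in> J" "max s t + e \<in> J"
    using d e by (auto simp: cball_def dist_real_def subset_iff)
  have sub: "{min s t - d..max s t + e} \<subseteq> J"
    by (rule subsetI, rule mem_is_interval_1_I[OF \<open>is_interval J\<close> mem]) auto
  show ?thesis
    by (rule that[OF _ _ _ _ sub]) (use d(1) e(1) in linarith)+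
qed

lemma antiderivative_on_open_interval:
  fixes f :: "real \<Rightarrow> 'a::banach"
  assumes J: "open J" "is_interval J" and "t0 \<in> J" and cont: "continuous_on J f"
  obtains F where "F t0 = 0" "\<And>t. t \<in> J \<Longrightarrow> (F has_vector_derivative f t) (at t)"
proof -
  \<comment> \<open>\<open>integral {t0..t} f\<close> is zero for \<open>t < t0\<close>, so the
    oriented integral is spelled out by cases.\<close>
  define F where "F t = (if t0 \<le> t then integral {t0..t} f else - integral {t..t0} f)" for t
  have "(F has_vector_derivative f t) (at t)" if "t \<in> J" for t
  proof -
    from that obtain a b where ab: "a < t0" "t0 < b" "a < t" "t < b" "{a..b} \<subseteq> J"
      using open_interval_cover[OF J \<open>t0 \<in> J\<close>] by metis
    have cab: "continuous_on {a..b} f" using cont ab continuous_on_subset by blast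
    have int: "f integrable_on {c..d}" if "a \<le> c" "d \<le> b" for c d
      by (rule integrable_continuous_real, rule continuous_on_subset[OF cab]) (use that in auto)
    \<comment> \<open>Moving the base point to \<open>a\<close>, left of both \<open>t0\<close> and
      \<open>t\<close>, merges the two cases into one formula that can be differentiated.\<close>
    have F: "integral {a..u} f - integral {a..t0} f = F u" if "u \<in> {a<..<b}" for u
    proof (cases "t0 \<le> u")
      case True
      then have "integral {a..t0} f + integral {t0..u} f = integral {a..u} f"
        using ab that by (intro Henstock_Kurzweil_Integration.integral_combine int) auto
      with True show ?thesis by (simp add: F_def algebra_simps)
    next
      case False
      then have "integral {a..u} f + integral {u..t0} f = integral {a..t0} f"
        using ab that by (intro Henstock_Kurzweil_Integration.integral_combine int) auto
      with False show ?thesis by (simp add: F_def algebra_simps)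
    qed
    have "((\<lambda>u. integral {a..u} f) has_vector_derivative f t) (at t within {a<..<b})"
      by (rule has_vector_derivative_within_subset[OF integral_has_vector_derivative[OF cab]]) (use ab in auto)
    then have "((\<lambda>u. integral {a..u} f - integral {a..t0} f) has_vector_derivative f t) (at t)"
      using at_within_open[of t "{a<..<b}"] ab(3,4) by (simp add: has_vector_derivative_diff_const)
    then show ?thesis
      by (rule has_vector_derivative_transform_within_open[where S = "{a<..<b}"]) (use ab(3,4) F in auto)
  qed
  moreover have "F t0 = 0" by (simp add: F_def)
  ultimately show thesis by (rule that[rotated])
qed

text \<open>The mean value inequality compares \<open>f\<close> with an antiderivative of the
  monomial bound, separately on each side of \<open>t0\<close>. It drives the induction on the terms
  of the Peano--Baker series.\<close>

lemma norm_diff_le_power: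
  fixes f :: "real \<Rightarrow> 'a::real_normed_vector"
  assumes "t0 \<in> {a..b}" "t \<in> {a..b}"
    and der: "\<And>s. s \<in> {a..b} \<Longrightarrow> (f has_vector_derivative f' s) (at s)"
    and bnd: "\<And>s. s \<in> {a..b} \<Longrightarrow> norm (f' s) \<le> c * \<bar>s - t0\<bar> ^ k"
  shows "norm (f t - f t0) \<le> c / real (Suc k) * \<bar>t - t0\<bar> ^ Suc k"
proof -
  have cont: "continuous_on {u..v} f" if "{u..v} \<subseteq> {a..b}" for u v
    using der that by (meson continuous_at_imp_continuous_on has_vector_derivative_continuous subsetD)
  consider "t = t0" | "t0 < t" | "t < t0" by linarith
  then show ?thesis
  proof cases
    case 2
    have "norm (f t - f t0) \<le> c / real (Suc k) * (t - t0) ^ Suc k - c / real (Suc k) * (t0 - t0) ^ Suc k"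
    proof (rule differentiable_bound_general[OF 2, where f' = f'
          and \<phi>' = "\<lambda>s. c / real (Suc k) * (real (Suc k) * (s - t0) ^ k)"])
      show "continuous_on {t0..t} f" using assms by (intro cont) auto
      show "continuous_on {t0..t} (\<lambda>s. c / real (Suc k) * (s - t0) ^ Suc k)"
        by (intro continuous_intros)
      fix s assume "t0 < s" "s < t"
      then have s: "s \<in> {a..b}" "s - t0 = \<bar>s - t0\<bar>" using assms(1,2) by auto
      show "(f has_vector_derivative f' s) (at s)" by (rule der[OF s(1)])
      show "((\<lambda>s. c / real (Suc k) * (s - t0) ^ Suc k)
          has_vector_derivative c / real (Suc k) * (real (Suc k) * (s - t0) ^ k)) (at s)"
        unfolding has_real_derivative_iff_has_vector_derivative[symmetric]
        by (auto intro!: derivative_eq_intros simp del: power_Suc of_nat_Suc)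
      show "norm (f' s) \<le> c / real (Suc k) * (real (Suc k) * (s - t0) ^ k)"
        using bnd[OF s(1)] by (subst s(2)) simp
    qed
    with 2 show ?thesis by simp
  next
    case 3
    have "norm (f t0 - f t) \<le> - (c / real (Suc k)) * (t0 - t0) ^ Suc k - (- (c / real (Suc k)) * (t0 - t) ^ Suc k)"
    proof (rule differentiable_bound_general[OF 3, where f' = f'
          and \<phi>' = "\<lambda>s. c / real (Suc k) * (real (Suc k) * (t0 - s) ^ k)"])
      show "continuous_on {t..t0} f" using assms by (intro cont) auto
      show "continuous_on {t..t0} (\<lambda>s. - (c / real (Suc k)) * (t0 - s) ^ Suc k)"
        by (intro continuous_intros)
      fix s assume "t < s" "s < t0"
      then have s: "s \<in> {a..b}" "t0 - s = \<bar>s - t0\<bar>" using assms(1,2) by auto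
      show "(f has_vector_derivative f' s) (at s)" by (rule der[OF s(1)])
      show "((\<lambda>s. - (c / real (Suc k)) * (t0 - s) ^ Suc k)
          has_vector_derivative c / real (Suc k) * (real (Suc k) * (t0 - s) ^ k)) (at s)"
        unfolding has_real_derivative_iff_has_vector_derivative[symmetric]
        by (auto intro!: derivative_eq_intros simp del: power_Suc of_nat_Suc)
      show "norm (f' s) \<le> c / real (Suc k) * (real (Suc k) * (t0 - s) ^ k)"
        using bnd[OF s(1)] by (subst s(2)) simp
    qed
    with 3 show ?thesis by (simp add: norm_minus_commute)
  qed auto
qed

section \<open>Existence and uniqueness for linear equations\<close>

text \<open>Picard iteration: on compact subintervals the series is dominated by an exponential
  series, so it and its termwise derivative converge uniformly. The product is an abstract bilinear
  map to cover matrix equations as well as vector equations.\<close>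

lemma linear_ode_exists:
  fixes pr :: "'a::real_normed_vector \<Rightarrow> 'b::banach \<Rightarrow> 'b"
  assumes pr: "bounded_bilinear pr"
    and J: "open J" "is_interval J" and t0: "t0 \<in> J" and A: "continuous_on J A"
  obtains x where "x t0 = v" "\<And>t. t \<in> J \<Longrightarrow> (x has_vector_derivative pr (A t) (x t)) (at t)"
proof -
  interpret bounded_bilinear pr by fact
  \<comment> \<open>\<open>\<Psi> k\<close> is the \<open>k\<close>-th term of the Peano--Baker series.\<close>
  have "\<exists>\<Psi>. \<forall>k. (continuous_on J (\<Psi> k) \<and> (k = 0 \<longrightarrow> \<Psi> k = (\<lambda>_. v))) \<and>
      (\<Psi> (Suc k) t0 = 0 \<and> (\<forall>t\<in>J. (\<Psi> (Suc k) has_vector_derivative pr (A t) (\<Psi> k t)) (at t)))"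
  proof (rule dependent_nat_choice, goal_cases)
    case (2 \<psi> k)
    then have "continuous_on J (\<lambda>t. pr (A t) (\<psi> t))" using A by (intro continuous_on) auto
    from antiderivative_on_open_interval[OF J t0 this] obtain F
      where F: "F t0 = 0" "\<And>t. t \<in> J \<Longrightarrow> (F has_vector_derivative pr (A t) (\<psi> t)) (at t)" by metis
    then have "continuous_on J F"
      by (meson continuous_at_imp_continuous_on has_vector_derivative_continuous)
    with F show ?case by auto
  qed (auto intro: exI[of _ "\<lambda>_. v"])
  then obtain \<Psi> where \<Psi>0: "\<Psi> 0 = (\<lambda>_. v)" and \<Psi>t0: "\<And>k. \<Psi> (Suc k) t0 = 0"
    and \<Psi>': "\<And>k t. t \<in> J \<Longrightarrow> (\<Psi> (Suc k) has_vector_derivative pr (A t) (\<Psi> k t)) (at t)"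
    by blast
  obtain Kp where Kp: "Kp > 0" "\<And>a x. norm (pr a x) \<le> norm a * norm x * Kp" using pos_bounded by blast
  define x where "x t = (\<Sum>k. \<Psi> k t)" for t
  have "(x has_vector_derivative pr (A t) (x t)) (at t)" if t: "t \<in> J" for t
  proof -
    obtain a b where ab: "a < t0" "t0 < b" "a < t" "t < b" "{a..b} \<subseteq> J"
      using open_interval_cover[OF J t0 t] by metis
    have "compact (A ` {a..b})"
      using A ab by (intro compact_continuous_image) (auto intro: continuous_on_subset)
    then obtain B where B: "B > 0" "\<And>s. s \<in> {a..b} \<Longrightarrow> norm (A s) \<le> B"
      using bounded_pos[of "A ` {a..b}"] compact_imp_bounded by blast
    define M where "M = B * Kp"
    have M: "M > 0" using B Kp by (simp add: M_def)
    have prM: "norm (pr (A s) y) \<le> M * norm y" if "s \<in> {a..b}" for s y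
    proof -
      have "norm (pr (A s) y) \<le> norm (A s) * norm y * Kp" by (rule Kp)
      also have "\<dots> \<le> B * norm y * Kp" using B that Kp by (intro mult_right_mono) auto
      finally show ?thesis by (simp add: M_def algebra_simps)
    qed
    have \<Psi>b: "norm (\<Psi> k s) \<le> norm v * M ^ k / fact k * \<bar>s - t0\<bar> ^ k" if "s \<in> {a..b}" for k s
      using that
    proof (induction k arbitrary: s)
      case 0
      then show ?case by (simp add: \<Psi>0)
    next
      case (Suc k)
      have "norm (\<Psi> (Suc k) s - \<Psi> (Suc k) t0)
          \<le> (norm v * M ^ Suc k / fact k) / real (Suc k) * \<bar>s - t0\<bar> ^ Suc k"
      proof (rule norm_diff_le_power[where f' = "\<lambda>s. pr (A s) (\<Psi> k s)"])
        fix u assume u: "u \<in> {a..b}"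
        show "(\<Psi> (Suc k) has_vector_derivative pr (A u) (\<Psi> k u)) (at u)" using \<Psi>' ab u by blast
        have "norm (pr (A u) (\<Psi> k u)) \<le> M * norm (\<Psi> k u)" by (rule prM[OF u])
        also have "\<dots> \<le> M * (norm v * M ^ k / fact k * \<bar>u - t0\<bar> ^ k)"
          using M Suc.IH[OF u] by (intro mult_left_mono) auto
        finally show "norm (pr (A u) (\<Psi> k u)) \<le> norm v * M ^ Suc k / fact k * \<bar>u - t0\<bar> ^ k"
          by (simp add: algebra_simps)
      qed (use ab Suc in auto)
      then show ?case by (simp add: \<Psi>t0 algebra_simps)
    qed
    \<comment> \<open>Terms of the series of \<open>norm v * exp (M * (b - a))\<close>, the majorant
      for the Weierstrass test.\<close>
    define w where "w k = norm v * (inverse (fact k) *\<^sub>R (M * (b - a)) ^ k)" for k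
    have sw: "summable w" unfolding w_def by (intro summable_mult summable_exp_generic)
    have \<Psi>w: "norm (\<Psi> k s) \<le> w k" if "s \<in> {a..b}" for k s
    proof -
      have "norm (\<Psi> k s) \<le> norm v * M ^ k / fact k * \<bar>s - t0\<bar> ^ k" by (rule \<Psi>b[OF that])
      also have "\<dots> \<le> norm v * M ^ k / fact k * (b - a) ^ k"
        using M that ab by (intro mult_left_mono power_mono) auto
      finally show ?thesis by (simp only: w_def power_mult_distrib) (simp add: field_simps)
    qed
    have unif: "uniform_limit {a..b} (\<lambda>n s. \<Sum>k<n. \<Psi> k s) x sequentially"
      unfolding x_def[abs_def] by (rule Weierstrass_m_test[OF \<Psi>w sw])
    have sums: "(\<lambda>k. \<Psi> k s) sums x s" if "s \<in> {a..b}" for s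
      unfolding x_def by (rule summable_sums, rule summable_comparison_test'[OF sw \<Psi>w[OF that]])
    \<comment> \<open>Termwise derivatives, with 0 for the constant term. Because of this shift,
      \<open>Suc n\<close> derivatives sum to \<open>pr (A s)\<close> applied to a partial sum of
      only \<open>n\<close> terms.\<close>
    define D where "D k s = (case k of 0 \<Rightarrow> 0 | Suc j \<Rightarrow> pr (A s) (\<Psi> j s))" for k s
    have Dsum: "(\<Sum>i<Suc n. D i s) = pr (A s) (\<Sum>k<n. \<Psi> k s)" for n s
      by (subst sum.lessThan_Suc_shift) (simp add: D_def sum_right)
    have "\<exists>g. \<forall>s\<in>{a<..<b}. (\<lambda>n. \<Psi> n s) sums g s \<and>
        (g has_derivative (\<lambda>h. h *\<^sub>R pr (A s) (x s))) (at s within {a<..<b})"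
    proof (rule has_derivative_series[where f' = "\<lambda>k s h. h *\<^sub>R D k s" and x = t])
      fix k s assume s: "s \<in> {a<..<b}"
      then have "s \<in> J" using ab by auto
      then have "(\<Psi> k has_vector_derivative D k s) (at s)"
        by (cases k) (auto simp: \<Psi>0 D_def intro: \<Psi>')
      then show "(\<Psi> k has_derivative (\<lambda>h. h *\<^sub>R D k s)) (at s within {a<..<b})"
        by (simp add: has_vector_derivative_def has_derivative_at_withinI)
    next
      fix e :: real assume e: "e > 0"
      have "\<forall>\<^sub>F n in sequentially. \<forall>s\<in>{a..b}. dist (\<Sum>k<n. \<Psi> k s) (x s) < e / M"
        using unif e M by (auto simp: uniform_limit_iff)
      then have "\<forall>\<^sub>F n in sequentially. \<forall>s\<in>{a<..<b}. \<forall>h.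
          norm ((\<Sum>i<Suc n. h *\<^sub>R D i s) - h *\<^sub>R pr (A s) (x s)) \<le> e * norm h"
      proof eventually_elim
        case (elim n)
        show ?case
        proof (intro ballI allI)
          fix s h assume s: "s \<in> {a<..<b}"
          have "norm (pr (A s) ((\<Sum>k<n. \<Psi> k s) - x s)) \<le> M * norm ((\<Sum>k<n. \<Psi> k s) - x s)"
            using s by (intro prM) auto
          also have "\<dots> \<le> M * (e / M)"
            using elim s M by (intro mult_left_mono) (auto simp: dist_norm less_imp_le)
          finally have "norm (pr (A s) ((\<Sum>k<n. \<Psi> k s) - x s)) \<le> e" using M by simp
          moreover have "(\<Sum>i<Suc n. h *\<^sub>R D i s) - h *\<^sub>R pr (A s) (x s)
              = h *\<^sub>R pr (A s) ((\<Sum>k<n. \<Psi> k s) - x s)"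
            by (simp add: scaleR_sum_right[symmetric] Dsum diff_right scaleR_diff_right del: sum.lessThan_Suc)
          ultimately show "norm ((\<Sum>i<Suc n. h *\<^sub>R D i s) - h *\<^sub>R pr (A s) (x s)) \<le> e * norm h"
            by (simp add: mult.commute[of e] mult_left_mono del: sum.lessThan_Suc)
        qed
      qed
      then show "\<forall>\<^sub>F n in sequentially. \<forall>s\<in>{a<..<b}. \<forall>h.
          norm ((\<Sum>i<n. h *\<^sub>R D i s) - h *\<^sub>R pr (A s) (x s)) \<le> e * norm h"
        by (rule eventually_sequentially_Suc[THEN iffD1])
    next
      show "convex {a<..<b}" "t \<in> {a<..<b}" using ab by auto
      show "(\<lambda>n. \<Psi> n t) sums x t" using sums ab by auto
    qed
    then obtain g where g: "\<And>s. s \<in> {a<..<b} \<Longrightarrow> (\<lambda>n. \<Psi> n s) sums g s"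
      "\<And>s. s \<in> {a<..<b} \<Longrightarrow> (g has_vector_derivative pr (A s) (x s)) (at s within {a<..<b})"
      unfolding has_vector_derivative_def by blast
    have gx: "g s = x s" if "s \<in> {a<..<b}" for s
      using g(1)[OF that] by (simp add: x_def sums_iff)
    have "(g has_vector_derivative pr (A t) (x t)) (at t)"
      using g(2)[of t] at_within_open[of t "{a<..<b}"] ab(3,4) by simp
    then show ?thesis
      by (rule has_vector_derivative_transform_within_open[where S = "{a<..<b}"]) (use ab(3,4) gx in auto)
  qed
  moreover have "x t0 = v"
  proof -
    have "\<Psi> k t0 = (if k = 0 then v else 0)" for k by (cases k) (auto simp: \<Psi>0 \<Psi>t0)
    then show ?thesis unfolding x_def using sums_single[of 0 "\<lambda>_. v"] by (simp add: sums_iff)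
  qed
  ultimately show thesis by (rule that[rotated])
qed

text \<open>A Gronwall argument for the squared norm \<open>r\<close>: since
  \<open>\<bar>r' s\<bar> \<le> 2 * M * r s\<close>, the weight \<open>exp (- 2 * M * t)\<close>
  makes \<open>r\<close> nonincreasing, which handles times after \<open>t0\<close>; the weight
  \<open>exp (2 * M * t)\<close> handles times before.\<close>

lemma linear_ode_unique_zero:
  fixes pr :: "'a::real_normed_vector \<Rightarrow> 'b::real_inner \<Rightarrow> 'b"
  assumes pr: "bounded_bilinear pr"
    and J: "open J" "is_interval J" and t0: "t0 \<in> J" and A: "continuous_on J A"
    and x: "\<And>t. t \<in> J \<Longrightarrow> (x has_vector_derivative pr (A t) (x t)) (at t)"
    and "x t0 = 0" and t: "t \<in> J"
  shows "x t = 0"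
proof -
  interpret bounded_bilinear pr by fact
  obtain Kp where Kp: "Kp > 0" "\<And>a x. norm (pr a x) \<le> norm a * norm x * Kp" using pos_bounded by blast
  obtain a b where ab: "a < t0" "t0 < b" "a < t" "t < b" "{a..b} \<subseteq> J"
    using open_interval_cover[OF J t0 t] by metis
  have "compact (A ` {a..b})"
    using A ab by (intro compact_continuous_image) (auto intro: continuous_on_subset)
  then obtain B where B: "B > 0" "\<And>s. s \<in> {a..b} \<Longrightarrow> norm (A s) \<le> B"
    using bounded_pos[of "A ` {a..b}"] compact_imp_bounded by blast
  define M where "M = B * Kp"
  define r where "r s = x s \<bullet> x s" for s
  define r' where "r' s = 2 * (x s \<bullet> pr (A s) (x s))" for s
  have r': "(r has_real_derivative r' s) (at s)" if "s \<in> {a..b}" for s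
  proof -
    have "(x has_derivative (\<lambda>h. h *\<^sub>R pr (A s) (x s))) (at s)"
      using x that ab by (auto simp: has_vector_derivative_def)
    from has_derivative_inner[OF this this] show ?thesis
      unfolding has_field_derivative_def r_def[abs_def] r'_def
      by (rule has_derivative_eq_rhs) (auto simp: inner_commute)
  qed
  have bnd: "\<bar>r' s\<bar> \<le> 2 * M * r s" if "s \<in> {a..b}" for s
  proof -
    have "\<bar>x s \<bullet> pr (A s) (x s)\<bar> \<le> norm (x s) * norm (pr (A s) (x s))" by (rule Cauchy_Schwarz_ineq2)
    also have "\<dots> \<le> norm (x s) * (B * norm (x s) * Kp)"
      using B(2)[OF that] Kp by (intro mult_left_mono order_trans[OF Kp(2)] mult_right_mono) auto
    finally show ?thesis by (simp add: r'_def M_def r_def dot_square_norm power2_eq_square algebra_simps)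
  qed
  have "r t \<le> 0"
  proof (cases "t0 \<le> t")
    case True
    have "r t * exp (- 2 * M * t) \<le> r t0 * exp (- 2 * M * t0)"
    proof (rule DERIV_nonpos_imp_nonincreasing[OF True])
      fix s assume "t0 \<le> s" "s \<le> t"
      then have s: "s \<in> {a..b}" using ab by auto
      have "((\<lambda>s. r s * exp (- 2 * M * s)) has_real_derivative (r' s - 2 * M * r s) * exp (- 2 * M * s)) (at s)"
        by (rule derivative_eq_intros r' s refl | simp add: algebra_simps)+
      moreover have "(r' s - 2 * M * r s) * exp (- 2 * M * s) \<le> 0"
        using bnd[OF s] by (intro mult_nonpos_nonneg) auto
      ultimately show "\<exists>y. ((\<lambda>s. r s * exp (- 2 * M * s)) has_real_derivative y) (at s) \<and> y \<le> 0" by blast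
    qed
    then show ?thesis using \<open>x t0 = 0\<close> by (simp add: r_def mult_le_0_iff not_le)
  next
    case False
    then have "t \<le> t0" by simp
    have "r t * exp (2 * M * t) \<le> r t0 * exp (2 * M * t0)"
    proof (rule DERIV_nonneg_imp_nondecreasing[OF \<open>t \<le> t0\<close>])
      fix s assume "t \<le> s" "s \<le> t0"
      then have s: "s \<in> {a..b}" using ab by auto
      have "((\<lambda>s. r s * exp (2 * M * s)) has_real_derivative (r' s + 2 * M * r s) * exp (2 * M * s)) (at s)"
        by (rule derivative_eq_intros r' s refl | simp add: algebra_simps)+
      moreover have "(r' s + 2 * M * r s) * exp (2 * M * s) \<ge> 0"
        using bnd[OF s] by (intro mult_nonneg_nonneg) auto
      ultimately show "\<exists>y. ((\<lambda>s. r s * exp (2 * M * s)) has_real_derivative y) (at s) \<and> 0 \<le> y" by blast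
    qed
    then show ?thesis using \<open>x t0 = 0\<close> by (simp add: r_def mult_le_0_iff not_le)
  qed
  then show ?thesis by (metis inner_ge_zero inner_eq_zero_iff order_antisym r_def)
qed

section \<open>Fundamental matrices\<close>

lemma bounded_bilinear_matrix_vector_mult: "bounded_bilinear ((*v) :: real^'n^'m \<Rightarrow> real^'n \<Rightarrow> real^'m)"
  by (auto simp: bilinear_conv_bounded_bilinear[symmetric] bilinear_def matrix_vector_mult_def vec_eq_iff
      sum.distrib sum_distrib_left algebra_simps intro!: linearI)

lemma bounded_bilinear_matrix_matrix_mult:
  "bounded_bilinear ((**) :: real^'n^'m \<Rightarrow> real^'p^'n \<Rightarrow> real^'p^'m)"
  by (auto simp: bilinear_conv_bounded_bilinear[symmetric] bilinear_def matrix_matrix_mult_def vec_eq_iff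
      sum.distrib sum_distrib_left algebra_simps intro!: linearI)

lemma fundamental_matrix_imp_solution:
  assumes "fundamental_matrix J A \<Phi>"
  shows "is_solution J A (\<lambda>t. \<Phi> t *v v)"
  unfolding is_solution_def
proof
  fix t assume "t \<in> J"
  then have "(\<Phi> has_vector_derivative (A t ** \<Phi> t)) (at t)"
    using assms by (simp add: fundamental_matrix_def)
  from bounded_linear.has_vector_derivative[OF bounded_bilinear.bounded_linear_left[OF bounded_bilinear_matrix_vector_mult] this]
  show "((\<lambda>t. \<Phi> t *v v) has_vector_derivative A t *v (\<Phi> t *v v)) (at t)"
    by (simp add: matrix_vector_mul_assoc)
qed

text \<open>The matrix equation is solved from the identity at \<open>t0\<close>. A kernel vector
  \<open>v\<close> of \<open>\<Phi> t\<close> yields a solution vanishing at \<open>t\<close>, hence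
  also at \<open>t0\<close>, where its value is \<open>v\<close>; so every \<open>\<Phi> t\<close>
  is injective.\<close>

lemma fundamental_matrix_exists:
  assumes J: "open J" "is_interval J" and "J \<noteq> {}" and A: "continuous_on J A"
  obtains \<Phi> where "fundamental_matrix J A \<Phi>"
proof -
  obtain t0 where t0: "t0 \<in> J" using \<open>J \<noteq> {}\<close> by blast
  obtain \<Phi> where \<Phi>: "\<Phi> t0 = mat 1" "\<And>t. t \<in> J \<Longrightarrow> (\<Phi> has_vector_derivative A t ** \<Phi> t) (at t)"
    using linear_ode_exists[OF bounded_bilinear_matrix_matrix_mult J t0 A, of "mat 1"] by metis
  have "invertible (\<Phi> t)" if t: "t \<in> J" for t
  proof -
    have "v = 0" if v: "\<Phi> t *v v = 0" for v
    proof -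
      have "((\<lambda>t. \<Phi> t *v v) has_vector_derivative A s *v (\<Phi> s *v v)) (at s)" if "s \<in> J" for s
        using bounded_linear.has_vector_derivative[OF bounded_bilinear.bounded_linear_left[OF bounded_bilinear_matrix_vector_mult] \<Phi>(2)[OF that]]
        by (simp add: matrix_vector_mul_assoc)
      from linear_ode_unique_zero[OF bounded_bilinear_matrix_vector_mult J t A this v t0] \<Phi>(1)
      show ?thesis by simp
    qed
    then show ?thesis
      by (simp add: invertible_left_inverse matrix_left_invertible_ker)
  qed
  with \<Phi>(2) have "fundamental_matrix J A \<Phi>" unfolding fundamental_matrix_def by blast
  then show ?thesis by (rule that)
qed

section \<open>Noncritical functions\<close>

lemma nat_floor_bounds:
  fixes d L :: real
  assumes "0 \<le> d" "0 < L"
  obtains n :: nat where "real n * L \<le> d" "d \<le> real (Suc n) * L"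
proof
  define n where "n = nat \<lfloor>d / L\<rfloor>"
  have n: "real n = of_int \<lfloor>d / L\<rfloor>" using assms by (simp add: n_def)
  have "real n \<le> d / L" "d / L \<le> real (Suc n)"
    unfolding of_nat_Suc n by linarith+
  then show "real n * L \<le> d" "d \<le> real (Suc n) * L"
    using assms by (simp_all add: pos_le_divide_eq pos_divide_le_eq)
qed

text \<open>\<open>f\<close> stands for the norm along one solution in logarithmic time. An
  arbitrary bound \<open>B\<close> replaces the supremum over the window, and
  \<open>L \<le> t\<close> keeps the window inside the nonnegative times.\<close>

locale noncritical =
  fixes f :: "real \<Rightarrow> real" and L C \<theta> :: real
  assumes nonneg: "0 \<le> f t"
    and L: "0 < L" and C: "1 < C" and \<theta>: "0 < \<theta>" "\<theta> < 1"
    and growth: "0 \<le> s \<Longrightarrow> s \<le> t \<Longrightarrow> t \<le> s + L \<Longrightarrow> f t \<le> C * f s"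
    and noncritical: "L \<le> t \<Longrightarrow> (\<And>u. t - L \<le> u \<Longrightarrow> u \<le> t + L \<Longrightarrow> f u \<le> B) \<Longrightarrow> f t \<le> \<theta> * B"
begin

text \<open>The rate at which one step of length \<open>L\<close> contributes exactly the factor
  \<theta>.\<close>

definition "\<alpha> = - ln \<theta> / L"

lemma \<alpha>_pos: "0 < \<alpha>"
  using L \<theta> by (simp add: \<alpha>_def divide_neg_pos)

lemma power_\<theta>_eq: "\<theta> ^ n = exp (- \<alpha> * (real n * L))"
proof -
  have "- \<alpha> * (real n * L) = real n * ln \<theta>" using L by (simp add: \<alpha>_def)
  with \<theta> show ?thesis by (simp add: exp_of_nat_mult)
qed

text \<open>The \<open>n\<close> whole steps may miss up to one step of the duration
  \<open>d\<close>; this costs the factor \<open>1 / \<theta>\<close>.\<close>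

lemma power_\<theta>_le_exp:
  assumes "d \<le> real (Suc n) * L"
  shows "\<theta> ^ n \<le> exp (- \<alpha> * d) / \<theta>"
proof -
  have "\<theta> ^ Suc n \<le> exp (- \<alpha> * d)"
    unfolding power_\<theta>_eq using assms \<alpha>_pos by simp
  with \<theta> show ?thesis by (simp add: field_simps)
qed

lemma growth_power:
  assumes "0 \<le> s" "s \<le> t" "t \<le> s + real n * L"
  shows "f t \<le> C ^ n * f s"
  using assms
proof (induction n arbitrary: t)
  case 0
  then show ?case by simp
next
  case (Suc n)
  \<comment> \<open>The last step may be shorter than \<open>L\<close>: \<open>r\<close> goes back
    from \<open>t\<close> by \<open>L\<close>, but never before \<open>s\<close>.\<close>
  define r where "r = max s (t - L)"
  have "f t \<le> C * f r" using Suc.prems L by (intro growth) (auto simp: r_def)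
  also have "\<dots> \<le> C * (C ^ n * f s)"
    using C Suc.prems L by (intro mult_left_mono Suc.IH) (auto simp: r_def algebra_simps)
  finally show ?case by simp
qed

section \<open>Decay of bounded functions\<close>

text \<open>The factor \<open>C\<close> comes from comparing the supremum over
  \<open>[s, \<infinity>)\<close> with \<open>f s\<close>, the factor \<open>1 / \<theta>\<close>
  from rounding \<open>t - s\<close> to whole steps.\<close>

lemma bounded_imp_decay:
  assumes bnd: "\<And>t. 0 \<le> t \<Longrightarrow> f t \<le> B" and "0 \<le> s" "s \<le> t"
  shows "f t \<le> C / \<theta> * exp (- \<alpha> * (t - s)) * f s"
proof -
  define \<mu> where "\<mu> = (SUP u\<in>{s..}. f u)"
  have bdd: "bdd_above (f ` {s..})"
    by (rule bdd_aboveI2[where M = B]) (use bnd \<open>0 \<le> s\<close> in auto)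
  \<comment> \<open>Beyond \<open>s + real (Suc n) * L\<close> the whole window lies beyond
    \<open>s + real n * L\<close>, where the induction hypothesis applies.\<close>
  have pow: "f u \<le> \<theta> ^ n * \<mu>" if "s + real n * L \<le> u" for n u
    using that
  proof (induction n arbitrary: u)
    case 0
    then show ?case using bdd by (auto simp: \<mu>_def intro: cSUP_upper)
  next
    case (Suc n)
    have "f u \<le> \<theta> * (\<theta> ^ n * \<mu>)"
    proof (rule noncritical)
      have "0 \<le> real n * L" using L by simp
      then show "L \<le> u" using Suc.prems \<open>0 \<le> s\<close> by (simp add: algebra_simps)
    qed (use Suc in \<open>auto simp: algebra_simps\<close>)
    then show ?case by simp
  qed
  \<comment> \<open>Beyond \<open>s + L\<close> the values are at most
    \<open>\<theta> * \<mu>\<close>, which for positive \<open>\<mu>\<close> cannot account for the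
    supremum; it comes from \<open>[s, s + L]\<close>, where growth gives
    \<open>C * f s\<close>.\<close>
  have \<mu>: "\<mu> \<le> C * f s"
  proof (rule ccontr)
    assume *: "\<not> \<mu> \<le> C * f s"
    have "(SUP u\<in>{s..}. f u) \<le> max (C * f s) (\<theta> * \<mu>)"
    proof (rule cSUP_least)
      fix u assume "u \<in> {s..}"
      then have "f u \<le> C * f s \<or> f u \<le> \<theta> * \<mu>"
        using growth[of s u] pow[of 1 u] \<open>0 \<le> s\<close> by (cases "u \<le> s + L") auto
      then show "f u \<le> max (C * f s) (\<theta> * \<mu>)" by auto
    qed auto
    with * have "\<mu> \<le> \<theta> * \<mu>" unfolding \<mu>_def[symmetric] by auto
    moreover have "0 < \<mu>" using * nonneg[of s] C by (smt (verit) mult_nonneg_nonneg)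
    ultimately show False using \<theta> by simp
  qed
  obtain n where n: "real n * L \<le> t - s" "t - s \<le> real (Suc n) * L"
    using nat_floor_bounds[of "t - s" L] \<open>s \<le> t\<close> L by auto
  have "f t \<le> \<theta> ^ n * \<mu>" using n by (intro pow) simp
  also have "\<dots> \<le> \<theta> ^ n * (C * f s)" using \<theta> \<mu> by (intro mult_left_mono) auto
  also have "\<dots> \<le> (exp (- \<alpha> * (t - s)) / \<theta>) * (C * f s)"
    using C nonneg n by (intro mult_right_mono power_\<theta>_le_exp) auto
  finally show ?thesis by (simp add: field_simps)
qed

section \<open>Running maximum and growth of unbounded functions\<close>

definition "M t = (SUP u\<in>{0..t}. f u)"

text \<open>The supremum is finite because bounded growth over finitely many steps bounds
  \<open>f\<close> on \<open>[0, t]\<close> by a multiple of \<open>f 0\<close>.\<close>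

lemma le_M: "0 \<le> u \<Longrightarrow> u \<le> t \<Longrightarrow> f u \<le> M t"
  unfolding M_def
proof (rule cSUP_upper)
  assume "0 \<le> u" "u \<le> t"
  then obtain n where n: "t \<le> real (Suc n) * L"
    using nat_floor_bounds[of t L] L by auto
  show "bdd_above (f ` {0..t})"
    by (rule bdd_aboveI2[where M = "C ^ Suc n * f 0"], rule growth_power) (use n in auto)
qed auto

lemma M_le: "0 \<le> t \<Longrightarrow> (\<And>u. 0 \<le> u \<Longrightarrow> u \<le> t \<Longrightarrow> f u \<le> B) \<Longrightarrow> M t \<le> B"
  unfolding M_def by (rule cSUP_least) auto

lemma M_mono: "0 \<le> s \<Longrightarrow> s \<le> t \<Longrightarrow> M s \<le> M t"
  by (rule M_le) (auto intro: le_M)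

text \<open>On \<open>[L, t]\<close> the windows stay inside \<open>[0, t + L]\<close>; on
  \<open>[0, L]\<close> growth gives the bound \<open>C * f 0\<close>, which lies below
  \<open>M t\<close> and so cannot determine it.\<close>

lemma M_step:
  assumes "0 \<le> t" "C * f 0 < M t"
  shows "M t \<le> \<theta> * M (t + L)"
proof -
  have "M t \<le> max (C * f 0) (\<theta> * M (t + L))"
  proof (rule M_le[OF \<open>0 \<le> t\<close>])
    fix u assume u: "0 \<le> u" "u \<le> t"
    have "f u \<le> \<theta> * M (t + L)" if "L \<le> u"
      using that u by (intro noncritical le_M) auto
    moreover have "f u \<le> C * f 0" if "u \<le> L" using that u by (intro growth) auto
    ultimately show "f u \<le> max (C * f 0) (\<theta> * M (t + L))" by linarith
  qed
  with assms show ?thesis by linarith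
qed

lemma M_power:
  assumes "0 \<le> t" "C * f 0 < M t"
  shows "M t \<le> \<theta> ^ n * M (t + real n * L)"
proof (induction n)
  case (Suc n)
  have nL: "0 \<le> real n * L" using L by simp
  have "C * f 0 < M (t + real n * L)"
    using assms M_mono[of t "t + real n * L"] nL by linarith
  then have "M (t + real n * L) \<le> \<theta> * M (t + real n * L + L)"
    using assms nL by (intro M_step) auto
  then have "\<theta> ^ n * M (t + real n * L) \<le> \<theta> ^ n * (\<theta> * M (t + real n * L + L))"
    using \<theta> by (intro mult_left_mono) auto
  with Suc show ?case by (simp add: algebra_simps)
qed simp

text \<open>If \<open>C * f s\<close> were below \<open>M s\<close>, bounded growth would keep
  \<open>f\<close> at most \<open>M s\<close> on \<open>[s, s + L]\<close>, so \<open>M\<close>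
  would stall over a full step, against \<open>M_step\<close>.\<close>

lemma M_le_growth:
  assumes "0 \<le> s" "C * f 0 < M s"
  shows "M s \<le> C * f s"
proof (rule ccontr)
  assume *: "\<not> M s \<le> C * f s"
  have "M (s + L) \<le> M s"
  proof (rule M_le)
    fix u assume "0 \<le> u" "u \<le> s + L"
    then show "f u \<le> M s"
      using le_M[of u s] growth[of s u] * \<open>0 \<le> s\<close> by (cases "u \<le> s") auto
  qed (use assms L in auto)
  then have "M s \<le> \<theta> * M s"
    using M_step[OF assms] \<theta> by (smt (verit) mult_left_mono)
  moreover have "0 < M s" using assms nonneg[of 0] C by (smt (verit) mult_nonneg_nonneg)
  ultimately show False using \<theta> by simp
qed

text \<open>An escape above \<open>C * f 0\<close> within the first \<open>k\<close> steps makes the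
  estimates for \<open>M\<close> available from time \<open>real k * L\<close> on; a constant
  depending on \<open>k\<close> absorbs earlier times.\<close>

lemma escape_imp_growth:
  assumes u: "0 \<le> u" "u \<le> real k * L" "C * f 0 < f u" and "0 \<le> t" "t \<le> s"
  shows "f t \<le> (C / \<theta>) ^ Suc k * exp (- \<alpha> * (s - t)) * f s"
proof -
  have kL: "0 \<le> real k * L" using L by simp
  \<comment> \<open>Both times are pushed to at least \<open>real k * L\<close>. Returning from
    \<open>s'\<close> to \<open>s\<close> costs \<open>C ^ k\<close>, and the duration of up to
    \<open>real k * L\<close> lost between them costs \<open>1 / \<theta> ^ k\<close>.\<close>
  define t' where "t' = max t (real k * L)"
  define s' where "s' = max s (real k * L)"
  have ts: "t \<le> t'" "0 \<le> t'" "t' \<le> s'" "s \<le> s'" "s' \<le> s + real k * L" "s - t \<le> s' - t' + real k * L"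
    using assms kL by (auto simp: t'_def s'_def)
  have "C * f 0 < M t'" "C * f 0 < M s'"
    using u le_M[of u t'] le_M[of u s'] by (fastforce simp: t'_def s'_def)+
  obtain n where n: "real n * L \<le> s' - t'" "s' - t' \<le> real (Suc n) * L"
    using nat_floor_bounds[of "s' - t'" L] ts L by auto
  have "f t \<le> M t'" using ts \<open>0 \<le> t\<close> by (intro le_M)
  also have "\<dots> \<le> \<theta> ^ n * M (t' + real n * L)" by (rule M_power) fact+
  also have "\<dots> \<le> \<theta> ^ n * M s'"
    using \<theta> n ts L by (intro mult_left_mono M_mono) auto
  also have "\<dots> \<le> \<theta> ^ n * (C * f s')"
    using \<theta> ts by (intro mult_left_mono M_le_growth) (auto simp: \<open>C * f 0 < M s'\<close>)
  also have "\<dots> \<le> \<theta> ^ n * (C * (C ^ k * f s))"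
    using \<theta> C ts assms by (intro mult_left_mono growth_power) auto
  also have "\<dots> = \<theta> ^ (n + k) / \<theta> ^ k * C ^ Suc k * f s"
    using \<theta> by (simp add: power_add)
  also have "\<dots> \<le> (exp (- \<alpha> * (s - t)) / \<theta>) / \<theta> ^ k * C ^ Suc k * f s"
  proof (intro mult_right_mono divide_right_mono power_\<theta>_le_exp)
    show "s - t \<le> real (Suc (n + k)) * L" using ts n by (simp add: algebra_simps)
  qed (use C \<theta> nonneg in auto)
  finally show ?thesis by (simp add: power_divide field_simps)
qed

end

section \<open>The splitting into bounded and unbounded trajectories\<close>

lemma is_norm_convex: "is_norm N \<Longrightarrow> convex_on UNIV N"
  unfolding is_norm_def by (intro convex_onI) (auto, smt (verit))

text \<open>Convex functions on a finite-dimensional space are continuous.\<close>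

lemma is_norm_continuous:
  fixes N :: "'a::euclidean_space \<Rightarrow> real"
  shows "is_norm N \<Longrightarrow> continuous_on UNIV N"
  by (intro convex_on_continuous is_norm_convex) auto

text \<open>\<open>X t v\<close> models the solution with parameter \<open>v\<close> at logarithmic
  time \<open>t\<close>. Having the whole \<open>N (X s v)\<close> on the right, not just its
  projected part, requires the projections to be bounded uniformly in \<open>s\<close>.\<close>

lemma noncritical_family_dichotomy:
  fixes X :: "real \<Rightarrow> 'a::euclidean_space \<Rightarrow> 'b::euclidean_space" and N :: "'b \<Rightarrow> real"
  assumes N: "is_norm N" and lin: "\<And>t. linear (X t)"
    and nc: "\<And>v. noncritical (\<lambda>t. N (X t v)) L C \<theta>"
  obtains P K \<alpha> where "linear P" "\<And>v. P (P v) = P v" "1 \<le> K" "0 < \<alpha>"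
    "\<And>v s t. 0 \<le> s \<Longrightarrow> s \<le> t \<Longrightarrow> N (X t (P v)) \<le> K * exp (- \<alpha> * (t - s)) * N (X s v)"
    "\<And>v s t. 0 \<le> t \<Longrightarrow> t \<le> s \<Longrightarrow> N (X t (v - P v)) \<le> K * exp (- \<alpha> * (s - t)) * N (X s v)"
proof -
  have N0: "N 0 = 0" "\<And>x. 0 \<le> N x" and Nadd: "\<And>x y. N (x + y) \<le> N x + N y"
    and Nscale: "\<And>c x. N (c *\<^sub>R x) = \<bar>c\<bar> * N x"
    using N by (auto simp: is_norm_def)
  have Nsub: "N (x - y) \<le> N x + N y" for x y
    using Nadd[of x "- y"] Nscale[of "-1" y] by simp
  note Ncont = is_norm_continuous[OF N]
  have C: "1 < C" and \<theta>: "0 < \<theta>" "\<theta> < 1" and L: "0 < L"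
    using nc[of 0] by (auto simp: noncritical_def)
  define \<beta> where "\<beta> = noncritical.\<alpha> L \<theta>"
  have \<beta>: "0 < \<beta>" unfolding \<beta>_def by (rule noncritical.\<alpha>_pos[OF nc])
  define V where "V = {v. \<exists>B. \<forall>t\<ge>0. N (X t v) \<le> B}"
  have "subspace V"
  proof (rule subspaceI)
    show "0 \<in> V" using linear_0[OF lin] N0 by (auto simp: V_def)
    fix x y assume "x \<in> V" "y \<in> V"
    then obtain B1 B2 where "\<And>t. t \<ge> 0 \<Longrightarrow> N (X t x) \<le> B1" "\<And>t. t \<ge> 0 \<Longrightarrow> N (X t y) \<le> B2"
      by (auto simp: V_def)
    then have "N (X t (x + y)) \<le> B1 + B2" if "t \<ge> 0" for t
      using Nadd[of "X t x" "X t y"] that by (fastforce simp: linear_add[OF lin])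
    then show "x + y \<in> V" by (auto simp: V_def)
  next
    fix c x assume "x \<in> V"
    then obtain B where "\<And>t. t \<ge> 0 \<Longrightarrow> N (X t x) \<le> B" by (auto simp: V_def)
    then have "N (X t (c *\<^sub>R x)) \<le> \<bar>c\<bar> * B" if "t \<ge> 0" for t
      using that by (simp add: linear_scale[OF lin] Nscale mult_left_mono)
    then show "c *\<^sub>R x \<in> V" by (auto simp: V_def)
  qed
  \<comment> \<open>A left inverse of the identity on \<open>V\<close> with range in
    \<open>V\<close> is a projection onto \<open>V\<close>; its kernel is the chosen
    complement.\<close>
  then obtain P where P: "linear P" "range P \<subseteq> V" "\<And>v. v \<in> V \<Longrightarrow> P v = v"
    using linear_exists_left_inverse_on[OF linear_id, of V] by (auto simp: id_def)
  have PP: "P (P v) = P v" for v using P by blast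
  have PV: "P v \<in> V" for v using P by blast
  have Pcont: "continuous_on UNIV P"
    using P(1) by (intro linear_continuous_on) (simp add: linear_conv_bounded_linear)

  \<comment> \<open>Otherwise normalised counterexamples accumulate at a nonzero vector of \<open>V\<close> in the kernel of \<open>P\<close>.\<close>
  have "\<exists>k. \<forall>v. P v = 0 \<longrightarrow> v \<noteq> 0 \<longrightarrow> (\<exists>u\<ge>0. u \<le> real k * L \<and> C * N (X 0 v) < N (X u v))"
  proof (rule ccontr)
    assume "\<not> ?thesis"
    then have "\<forall>k. \<exists>v. P v = 0 \<and> v \<noteq> 0 \<and> (\<forall>u\<ge>0. u \<le> real k * L \<longrightarrow> N (X u v) \<le> C * N (X 0 v))"
      by (simp add: not_less) blast
    then obtain v where v: "\<And>k. P (v k) = 0" "\<And>k. v k \<noteq> 0"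
      "\<And>k u. 0 \<le> u \<Longrightarrow> u \<le> real k * L \<Longrightarrow> N (X u (v k)) \<le> C * N (X 0 (v k))"
      by metis
    define w where "w k = (1 / norm (v k)) *\<^sub>R v k" for k
    have w: "P (w k) = 0" "norm (w k) = 1" for k
      using v by (auto simp: w_def linear_scale[OF P(1)])
    have wX: "N (X u (w k)) \<le> C * N (X 0 (w k))" if "0 \<le> u" "u \<le> real k * L" for u k
      using v(3)[OF that] by (simp add: w_def linear_scale[OF lin] Nscale divide_right_mono)
    have "compact (sphere 0 1 :: 'a set)" by simp
    then obtain l r where l: "l \<in> sphere 0 1" and r: "strict_mono r" "(w \<circ> r) \<longlonglongrightarrow> l"
      using w(2) by (metis compact_def dist_0_norm mem_sphere seq_compactE compact_imp_seq_compact)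
    have lim: "(\<lambda>k. N (X u (w (r k)))) \<longlonglongrightarrow> N (X u l)" for u
    proof -
      have "continuous_on UNIV (\<lambda>x. N (X u x))"
        using lin by (intro continuous_on_compose2[OF Ncont] linear_continuous_on)
          (auto simp: linear_conv_bounded_linear)
      from continuous_on_tendsto_compose[OF this r(2)] show ?thesis by simp
    qed
    \<comment> \<open>For fixed \<open>u\<close> the bound holds for all
      \<open>k \<ge> u / L\<close>, because \<open>r k \<ge> k\<close>; so it survives the limit and
      shows that \<open>l\<close> has a bounded trajectory.\<close>
    have "N (X u l) \<le> C * N (X 0 l)" if "u \<ge> 0" for u
    proof (rule tendsto_le[OF _ tendsto_mult_left[OF lim] lim])
      have "\<forall>\<^sub>F k in sequentially. u / L \<le> real k"
        using filterlim_real_sequentially by (simp add: filterlim_at_top)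
      then show "\<forall>\<^sub>F k in sequentially. N (X u (w (r k))) \<le> C * N (X 0 (w (r k)))"
      proof eventually_elim
        case (elim k)
        also have "real k \<le> real (r k)" using seq_suble[OF r(1)] by simp
        finally show ?case using L that by (intro wX) (auto simp: field_simps)
      qed
    qed simp
    then have "l \<in> V" by (auto simp: V_def)
    then have "P l = l" by (rule P)
    moreover have "(\<lambda>k. P (w (r k))) \<longlonglongrightarrow> P l"
      using continuous_on_tendsto_compose[OF Pcont r(2)] by simp
    then have "P l = 0" using w by (simp add: LIMSEQ_const_iff)
    ultimately show False using l by simp
  qed
  then obtain k where k: "\<And>v. P v = 0 \<Longrightarrow> v \<noteq> 0 \<Longrightarrow> \<exists>u\<ge>0. u \<le> real k * L \<and> C * N (X 0 v) < N (X u v)"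
    by blast

  \<comment> \<open>The constant of \<open>escape_imp_growth\<close>; it also dominates the constant
    \<open>C / \<theta>\<close> of \<open>bounded_imp_decay\<close>.\<close>
  define K where "K = (C / \<theta>) ^ Suc k"
  have C\<theta>: "1 \<le> C / \<theta>" using C \<theta> by simp
  have K1: "1 \<le> K" unfolding K_def using C\<theta> by (rule one_le_power)
  have CK: "C / \<theta> \<le> K" unfolding K_def using C\<theta> power_increasing[of 1 "Suc k" "C / \<theta>"] by simp
  have decay: "N (X t (P v)) \<le> K * exp (- \<beta> * (t - s)) * N (X s (P v))" if "0 \<le> s" "s \<le> t" for s t v
  proof -
    interpret noncritical "\<lambda>t. N (X t (P v))" L C \<theta> by (rule nc)
    obtain B where B: "\<And>t. 0 \<le> t \<Longrightarrow> N (X t (P v)) \<le> B" using PV[of v] by (auto simp: V_def)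
    from bounded_imp_decay[OF this that]
    have "N (X t (P v)) \<le> C / \<theta> * exp (- \<beta> * (t - s)) * N (X s (P v))" by (simp add: \<beta>_def)
    also have "\<dots> \<le> K * exp (- \<beta> * (t - s)) * N (X s (P v))"
      using CK N0 by (intro mult_right_mono) auto
    finally show ?thesis .
  qed
  have expand: "N (X t (v - P v)) \<le> K * exp (- \<beta> * (s - t)) * N (X s (v - P v))" if "0 \<le> t" "t \<le> s" for s t v
  proof (cases "v - P v = 0")
    case True
    then show ?thesis by (simp add: linear_0[OF lin] N0)
  next
    case False
    interpret noncritical "\<lambda>t. N (X t (v - P v))" L C \<theta> by (rule nc)
    have "P (v - P v) = 0" by (simp add: linear_diff[OF P(1)] PP)
    from k[OF this False] escape_imp_growth[of _ k] that show ?thesis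
      unfolding K_def \<beta>_def by blast
  qed

  \<comment> \<open>After \<open>j\<close> steps the unbounded part has at least doubled and the bounded part at least halved,
    while the sum has grown by at most \<open>C ^ j\<close>: the two parts cannot nearly cancel.\<close>
  obtain j where j: "K * \<theta> ^ j \<le> 1 / 2"
  proof -
    obtain j where "\<theta> ^ j < 1 / (2 * K)" using real_arch_pow_inv[of "1 / (2 * K)" \<theta>] \<theta> K1 by auto
    with K1 that[of j] show thesis by (simp add: field_simps)
  qed
  have Q: "N (X s (v - P v)) \<le> (C ^ j + 1) * N (X s v)" if "0 \<le> s" for s v
  proof -
    define r where "r = s + real j * L"
    have r: "s \<le> r" using L by (simp add: r_def)
    have q: "K * exp (- \<beta> * (r - s)) \<le> 1 / 2"
      using j noncritical.power_\<theta>_eq[OF nc, of j] by (simp add: r_def \<beta>_def)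
    have half: "K * exp (- \<beta> * (r - s)) * x \<le> 1 / 2 * x" if "0 \<le> x" for x
      using q that by (rule mult_right_mono)
    have eq: "X t v - X t (P v) = X t (v - P v)" for t by (simp add: linear_diff[OF lin])
    have "N (X s (v - P v)) \<le> 1 / 2 * N (X r (v - P v))"
      using expand[OF that r, of v] half[of "N (X r (v - P v))"] N0 by simp
    moreover have "N (X r (v - P v)) \<le> N (X r v) + N (X r (P v))"
      using Nsub[of "X r v" "X r (P v)"] by (simp add: eq)
    moreover have "N (X r v) \<le> C ^ j * N (X s v)"
      by (rule noncritical.growth_power[OF nc]) (use that r in \<open>auto simp: r_def\<close>)
    moreover have "N (X r (P v)) \<le> 1 / 2 * N (X s (P v))"
      using decay[OF that r, of v] half[of "N (X s (P v))"] N0 by simp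
    moreover have "N (X s (P v)) \<le> N (X s v) + N (X s (v - P v))"
      using Nsub[of "X s v" "X s (v - P v)"] by (simp add: eq[symmetric])
    moreover have "0 \<le> C ^ j * N (X s v)" "0 \<le> N (X s v)" using C N0 by auto
    \<comment> \<open>With \<open>a = N (X s (v - P v))\<close> and \<open>b = N (X s v)\<close> the
      facts chain to \<open>2 * a \<le> C ^ j * b + (b + a) / 2\<close>.\<close>
    ultimately show ?thesis by (simp add: algebra_simps)
  qed
  have P': "N (X s (P v)) \<le> (C ^ j + 2) * N (X s v)" if "0 \<le> s" for s v
    using Q[OF that, of v] Nsub[of "X s v" "X s (v - P v)"]
    by (simp add: linear_diff[OF lin] algebra_simps)
  show thesis
  proof (rule that[of P "K * (C ^ j + 2)" \<beta>])
    have "1 \<le> C ^ j + 2" using C one_le_power[of C j] by simp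
    then show "1 \<le> K * (C ^ j + 2)" using K1 by (metis mult_mono mult_1 zero_le_one order_trans)
    fix v s t assume "0 \<le> s" "s \<le> (t::real)"
    have "N (X t (P v)) \<le> K * exp (- \<beta> * (t - s)) * N (X s (P v))" by (rule decay) fact+
    also have "\<dots> \<le> K * exp (- \<beta> * (t - s)) * ((C ^ j + 2) * N (X s v))"
      using K1 by (intro mult_left_mono P' \<open>0 \<le> s\<close>) auto
    finally show "N (X t (P v)) \<le> K * (C ^ j + 2) * exp (- \<beta> * (t - s)) * N (X s v)"
      by (simp add: mult_ac)
  next
    fix v s t assume "0 \<le> t" "t \<le> (s::real)"
    have "N (X s (v - P v)) \<le> (C ^ j + 1) * N (X s v)"
      by (rule Q) (use \<open>0 \<le> t\<close> \<open>t \<le> s\<close> in simp)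
    also have "\<dots> \<le> (C ^ j + 2) * N (X s v)" using N0 by (intro mult_right_mono) auto
    finally have *: "N (X s (v - P v)) \<le> (C ^ j + 2) * N (X s v)" .
    have "N (X t (v - P v)) \<le> K * exp (- \<beta> * (s - t)) * N (X s (v - P v))" by (rule expand) fact+
    also have "\<dots> \<le> K * exp (- \<beta> * (s - t)) * ((C ^ j + 2) * N (X s v))"
      using K1 by (intro mult_left_mono *) auto
    finally show "N (X t (v - P v)) \<le> K * (C ^ j + 2) * exp (- \<beta> * (s - t)) * N (X s v)"
      by (simp add: mult_ac)
  qed (use P PP \<beta> in auto)
qed

section \<open>The dichotomy\<close>

lemma induced_norm_le:
  fixes N :: "real^'n \<Rightarrow> real"
  assumes N: "is_norm N" and bnd: "\<And>x. N (M *v x) \<le> c * N x"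
  shows "induced_norm N M \<le> c"
  unfolding induced_norm_def
proof (rule cSUP_least)
  \<comment> \<open>The supremum needs a nonempty unit sphere; a rescaled basis vector lies on
    it.\<close>
  obtain b :: "real^'n" where "b \<in> Basis" using nonempty_Basis by blast
  then have "N b \<noteq> 0" using N by (auto simp: is_norm_def)
  moreover have "\<And>c x. N (c *\<^sub>R x) = \<bar>c\<bar> * N x" "0 \<le> N b" using N by (auto simp: is_norm_def)
  ultimately have "N ((1 / N b) *\<^sub>R b) = 1" by simp
  then show "{x. N x = 1} \<noteq> {}" by blast
next
  fix x assume "x \<in> {x. N x = 1}"
  then show "N (M *v x) \<le> c" using bnd[of x] by simp
qed

text \<open>The projection of parameters is transported along the flow by conjugation with
  \<open>\<Phi> t\<close>, so that invariance is automatic. The estimates for a vector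
  \<open>x\<close> at time \<open>s\<close> are those for the parameter
  \<open>matrix_inv (\<Phi> s) *v x\<close>.\<close>

lemma dichotomy_from_projection:
  fixes \<Phi> :: "real \<Rightarrow> real^'n^'n" and N :: "real^'n \<Rightarrow> real"
  assumes N: "is_norm N" and I: "is_interval I" "I \<subseteq> J"
    and \<Phi>: "fundamental_matrix J A \<Phi>" and P: "linear P" "\<And>v. P (P v) = P v"
    and K: "1 \<le> K" and "0 < \<alpha>"
    and stable: "\<And>v s t. s \<in> I \<Longrightarrow> t \<in> I \<Longrightarrow> s \<le> t \<Longrightarrow>
      N (\<Phi> t *v P v) \<le> K * (h t / h s) powr (- \<alpha>) * N (\<Phi> s *v v)"
    and unstable: "\<And>v s t. s \<in> I \<Longrightarrow> t \<in> I \<Longrightarrow> t \<le> s \<Longrightarrow>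
      N (\<Phi> t *v (v - P v)) \<le> K * (h s / h t) powr (- \<alpha>) * N (\<Phi> s *v v)"
  shows "uniform_dichotomy J h N A I"
proof -
  define R where "R = matrix P"
  have R: "R *v v = P v" for v using P(1) by (simp add: R_def matrix_works)
  have RR: "R ** R = R"
    by (simp add: matrix_eq matrix_vector_mul_assoc[symmetric] R P)
  define Q where "Q t = \<Phi> t ** R ** matrix_inv (\<Phi> t)" for t
  \<comment> \<open>\<open>matrix_inv\<close> is defined by choice, so both inverse laws are
    extracted from invertibility.\<close>
  have inv: "matrix_inv (\<Phi> t) ** \<Phi> t = mat 1" "\<Phi> t ** matrix_inv (\<Phi> t) = mat 1" if "t \<in> J" for t
    using \<Phi> that someI_ex[of "\<lambda>B. \<Phi> t ** B = mat 1 \<and> B ** \<Phi> t = mat 1"]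
    by (auto simp: fundamental_matrix_def invertible_def matrix_inv_def)
  have cancel: "matrix_inv (\<Phi> t) ** (\<Phi> t ** B) = B" "\<Phi> t ** (matrix_inv (\<Phi> t) ** B) = B"
    if "t \<in> J" for t and B :: "real^'n^'n"
    using inv[OF that] by (simp_all add: matrix_mul_assoc)
  have tP: "transition \<Phi> t s ** Q s = \<Phi> t ** (R ** matrix_inv (\<Phi> s))" if "s \<in> J" for s t
    unfolding transition_def Q_def by (simp add: matrix_mul_assoc[symmetric] cancel that)
  have vs: "\<Phi> s *v (matrix_inv (\<Phi> s) *v x) = x" if "s \<in> J" for s x
    using inv[OF that] by (simp add: matrix_vector_mul_assoc)
  show ?thesis
    unfolding uniform_dichotomy_def
  proof (intro conjI, fact, fact, rule exI[of _ \<Phi>], rule exI[of _ Q], rule exI[of _ K],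
      rule exI[of _ \<alpha>], intro conjI ballI impI)
    fix t assume t: "t \<in> J"
    have "R ** (R ** B) = R ** B" for B :: "real^'n^'n" by (simp add: matrix_mul_assoc RR)
    with t show "Q t ** Q t = Q t" unfolding Q_def
      by (simp add: matrix_mul_assoc[symmetric] cancel)
    fix s assume s: "s \<in> J"
    with t show "Q t ** transition \<Phi> t s = transition \<Phi> t s ** Q s"
      by (simp only: tP) (simp add: Q_def transition_def matrix_mul_assoc[symmetric] cancel)
  next
    fix t s assume ts: "t \<in> I" "s \<in> I" "s \<le> t"
    then have s: "s \<in> J" using I by blast
    show "induced_norm N (transition \<Phi> t s ** Q s) \<le> K * (h t / h s) powr (- \<alpha>)"
    proof (rule induced_norm_le[OF N])
      fix x
      show "N ((transition \<Phi> t s ** Q s) *v x) \<le> K * (h t / h s) powr (- \<alpha>) * N x"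
        using stable[OF ts(2,1,3), of "matrix_inv (\<Phi> s) *v x"]
        by (simp add: tP s vs R matrix_vector_mul_assoc[symmetric])
    qed
  next
    fix t s assume ts: "t \<in> I" "s \<in> I" "t \<le> s"
    then have s: "s \<in> J" using I by blast
    show "induced_norm N (transition \<Phi> t s ** (mat 1 - Q s)) \<le> K * (h s / h t) powr (- \<alpha>)"
    proof (rule induced_norm_le[OF N])
      fix x
      have "(transition \<Phi> t s ** (mat 1 - Q s)) *v x
          = transition \<Phi> t s *v x - (transition \<Phi> t s ** Q s) *v x"
        by (simp add: matrix_vector_mul_assoc[symmetric] matrix_vector_mult_diff_rdistrib
            matrix_vector_mult_diff_distrib)
      also have "\<dots> = \<Phi> t *v (matrix_inv (\<Phi> s) *v x - P (matrix_inv (\<Phi> s) *v x))"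
        unfolding tP[OF s] by (simp add: transition_def matrix_vector_mult_diff_distrib
            matrix_vector_mul_assoc[symmetric] R)
      finally show "N ((transition \<Phi> t s ** (mat 1 - Q s)) *v x) \<le> K * (h s / h t) powr (- \<alpha>) * N x"
        using unstable[OF ts(2,1,3), of "matrix_inv (\<Phi> s) *v x"] by (simp add: vs s)
    qed
  qed fact+
qed

theorem theorem1:
  fixes J :: "real set"
    and A :: "real \<Rightarrow> real^'n^'n"
    and N :: "real^'n \<Rightarrow> real"
    and h :: "real \<Rightarrow> real"
    and T C \<theta> :: real
  assumes "J = UNIV \<or> (\<exists>a0. J = {a0<..})"
    and "continuous_on J A"
    and "is_norm N"
    and "growth_rate J h"
    and "T > star_unit J h" and "C > 1" and "0 < \<theta>" and "\<theta> < 1"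
    and "\<And>x s t. is_solution J A x \<Longrightarrow> star_unit J h \<le> s \<Longrightarrow> s \<le> t \<Longrightarrow> t \<le> star J h s T
           \<Longrightarrow> N (x t) \<le> C * N (x s)"
    and "\<And>x t. is_solution J A x \<Longrightarrow> T \<le> t
           \<Longrightarrow> N (x t) \<le> \<theta> * (SUP u\<in>{u\<in>J. star_abs J h (star J h u (star_inv J h t)) \<le> T}. N (x u))"
  shows "uniform_dichotomy J h N A {star_unit J h..}"
proof -
  \<comment> \<open>\<open>g\<close> inverts \<open>ln (h t)\<close>: it turns addition of
    logarithmic times into the group operation, with \<open>g 0\<close> the unit and
    \<open>g L = T\<close>.\<close>
  define g where "g \<tau> = inv_into J h (exp \<tau>)" for \<tau>
  define L where "L = ln (h T)"
  have mono: "strict_mono_on J h" and hJ: "h ` J = {0<..}"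
    using \<open>growth_rate J h\<close> by (auto simp: growth_rate_def homeomorphism_def)
  have inj: "inj_on h J" using mono by (rule strict_mono_on_imp_inj_on)
  have gJ: "g \<tau> \<in> J" and hg: "h (g \<tau>) = exp \<tau>" for \<tau>
    using hJ by (auto simp: g_def inv_into_into f_inv_into_f)
  have hpos: "0 < h t" if "t \<in> J" for t using hJ that by auto
  have gh: "g (ln (h t)) = t" if "t \<in> J" for t
    using that hpos[OF that] inj by (simp add: g_def)
  have g_le: "g \<sigma> \<le> g \<tau> \<longleftrightarrow> \<sigma> \<le> \<tau>" for \<sigma> \<tau>
    using strict_mono_on_less_eq[OF mono gJ gJ, of \<sigma> \<tau>] by (simp add: hg)
  have g_star: "star J h (g \<sigma>) (g \<tau>) = g (\<sigma> + \<tau>)" for \<sigma> \<tau>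
    by (simp add: star_def hg) (simp add: g_def exp_add)
  have g_inv: "star_inv J h (g \<tau>) = g (- \<tau>)" for \<tau>
    by (simp add: star_inv_def hg) (simp add: g_def exp_minus field_simps)
  have unit: "star_unit J h = g 0" by (simp add: star_unit_def g_def)
  have upJ: "t \<in> J" if "g \<tau> \<le> t" for t \<tau>
    using assms(1) gJ[of \<tau>] that by auto
  have T: "T = g L" "T \<in> J"
    using upJ[of 0 T] assms(5) unit gh by (auto simp: L_def)
  have L: "0 < L" using assms(5) g_le[of L 0] T unit by linarith
  have J: "open J" "is_interval J" "J \<noteq> {}" using assms(1) gJ by auto
  \<comment> \<open>In logarithmic time \<open>star_abs\<close> of the quotient is
    \<open>g \<bar>\<sigma> - \<tau>\<bar>\<close>, so the window is the symmetric interval of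
    radius \<open>L\<close>.\<close>
  have window: "{u \<in> J. star_abs J h (star J h u (star_inv J h (g \<tau>))) \<le> T} = g ` {\<tau> - L..\<tau> + L}" for \<tau>
  proof -
    have "star_abs J h (star J h (g \<sigma>) (star_inv J h (g \<tau>))) = g \<bar>\<sigma> - \<tau>\<bar>" for \<sigma>
      by (auto simp: g_inv g_star star_abs_def unit g_le abs_if)
    then have *: "star_abs J h (star J h (g \<sigma>) (star_inv J h (g \<tau>))) \<le> T \<longleftrightarrow> \<sigma> \<in> {\<tau> - L..\<tau> + L}" for \<sigma>
      by (auto simp: T g_le)
    show ?thesis
    proof (intro subset_antisym subsetI)
      fix u assume "u \<in> {u \<in> J. star_abs J h (star J h u (star_inv J h (g \<tau>))) \<le> T}"
      then show "u \<in> g ` {\<tau> - L..\<tau> + L}" using *[of "ln (h u)"] gh[of u] by force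
    next
      fix u assume "u \<in> g ` {\<tau> - L..\<tau> + L}"
      then show "u \<in> {u \<in> J. star_abs J h (star J h u (star_inv J h (g \<tau>))) \<le> T}"
        using * gJ by auto
    qed
  qed
  obtain \<Phi> where \<Phi>: "fundamental_matrix J A \<Phi>"
    using fundamental_matrix_exists[OF J assms(2)] by blast
  note sol = fundamental_matrix_imp_solution[OF \<Phi>]
  have nc: "noncritical (\<lambda>\<tau>. N (\<Phi> (g \<tau>) *v v)) L C \<theta>" for v
  proof
    show "0 \<le> N (\<Phi> (g \<tau>) *v v)" for \<tau> using assms(3) by (auto simp: is_norm_def)
    show "N (\<Phi> (g \<tau>) *v v) \<le> C * N (\<Phi> (g \<sigma>) *v v)" if "0 \<le> \<sigma>" "\<sigma> \<le> \<tau>" "\<tau> \<le> \<sigma> + L" for \<sigma> \<tau>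
      using that by (intro assms(9)[OF sol]) (auto simp: unit T g_star g_le)
    show "N (\<Phi> (g \<tau>) *v v) \<le> \<theta> * B"
      if "L \<le> \<tau>" "\<And>u. \<tau> - L \<le> u \<Longrightarrow> u \<le> \<tau> + L \<Longrightarrow> N (\<Phi> (g u) *v v) \<le> B" for \<tau> B
    proof -
      have "N (\<Phi> (g \<tau>) *v v) \<le> \<theta> * (SUP u\<in>g ` {\<tau> - L..\<tau> + L}. N (\<Phi> u *v v))"
        using assms(10)[OF sol, of "g \<tau>" v] that by (simp add: T(1) g_le window[unfolded T(1)])
      \<comment> \<open>Any bound on the nonempty window dominates the supremum, which yields the
        form with \<open>B\<close>.\<close>
      also have "(SUP u\<in>g ` {\<tau> - L..\<tau> + L}. N (\<Phi> u *v v)) \<le> B"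
        using L that by (intro cSUP_least) auto
      finally show ?thesis using assms(7) by simp
    qed
  qed (use L assms in auto)
  obtain P K \<alpha> where P: "linear P" "\<And>v. P (P v) = P v" and K: "1 \<le> K" "0 < \<alpha>"
    and st: "\<And>v s t. 0 \<le> s \<Longrightarrow> s \<le> t \<Longrightarrow>
      N (\<Phi> (g t) *v P v) \<le> K * exp (- \<alpha> * (t - s)) * N (\<Phi> (g s) *v v)"
    and un: "\<And>v s t. 0 \<le> t \<Longrightarrow> t \<le> s \<Longrightarrow>
      N (\<Phi> (g t) *v (v - P v)) \<le> K * exp (- \<alpha> * (s - t)) * N (\<Phi> (g s) *v v)"
    using noncritical_family_dichotomy[OF assms(3) matrix_vector_mul_linear nc] by blast
  \<comment> \<open>Powers of ratios of \<open>h\<close> are exponentials of differences of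
    logarithmic times, so \<alpha> carries over unchanged.\<close>
  have rate: "(h (g \<sigma>) / h (g \<tau>)) powr (- \<alpha>) = exp (- \<alpha> * (\<sigma> - \<tau>))" for \<sigma> \<tau>
    by (simp add: hg exp_diff[symmetric] powr_def)
  have coord: "\<exists>\<tau>\<ge>0. t = g \<tau>" if "t \<in> {star_unit J h..}" for t
    using that upJ[of 0 t] gh[of t] g_le[of 0 "ln (h t)"] unit by force
  show ?thesis
  proof (rule dichotomy_from_projection[OF assms(3) _ _ \<Phi> P K])
    show "is_interval {star_unit J h..}" by simp
    show "{star_unit J h..} \<subseteq> J" using upJ unit by auto
    fix v s t assume "s \<in> {star_unit J h..}" "t \<in> {star_unit J h..}"
    then obtain \<sigma> \<tau> where "0 \<le> \<sigma>" "s = g \<sigma>" "0 \<le> \<tau>" "t = g \<tau>" using coord by blast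
    then show "s \<le> t \<Longrightarrow> N (\<Phi> t *v P v) \<le> K * (h t / h s) powr (- \<alpha>) * N (\<Phi> s *v v)"
      and "t \<le> s \<Longrightarrow> N (\<Phi> t *v (v - P v)) \<le> K * (h s / h t) powr (- \<alpha>) * N (\<Phi> s *v v)"
      using st un by (simp_all only: rate g_le)
  qed
qed

end
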